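(* Let $d\ge 1$ be an integer. There is a constant $C_d$ depending only on $d$ such that for every $\delta\in(0,1)$ there exists a compact subset $K_\delta\subseteq\mathbb{R}^{d+1}$ with the following two properties: (i) for every $r\in[1,2]$, $K_\delta$ contains a $d$-sphere of radius $r$, i.e. there is $c\in\mathbb{R}^{d+1}$ with $\{x\in\mathbb{R}^{d+1}:|x-c|=r\}\subseteq K_\delta$; (ii) $|N_\delta(K_\delta)|\le C_d\,|\log\delta|^{-2/d}$.
   Context: $N_\delta(S)$ denotes the $\delta$-neighbourhood of a set $S\subseteq\mathbb{R}^{d+1}$, and $|\cdot|$ applied to a set denotes Lebesgue measure (here in $\mathbb{R}^{d+1}$); $|\cdot|$ applied to a vector is the Euclidean norm. *)

theory Defs
  imports "HOL-Analysis.Analysis"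
begin

text \<open>The open \<open>\<delta>\<close>-neighbourhood of a set.\<close>

definition nbhd :: "real \<Rightarrow> 'a::metric_space set \<Rightarrow> 'a set" where
  "nbhd \<delta> S = {x. \<exists>y\<in>S. dist x y < \<delta>}"

end

theory Submission
  imports Defs
begin

text \<open>
  For \<open>A \<subseteq> {..<n}\<close> take the radius \<open>r\<^sub>A = 1 + (\<Sum>j\<in>A. 2\<^sup>-\<^sup>j\<^sup>-\<^sup>1)\<close> and the centre
  \<open>c\<^sub>A = - (\<Sum>j\<in>A. 2\<^sup>-\<^sup>j\<^sup>-\<^sup>1 e\<^sub>j)\<close>, where \<open>e\<^sub>0, e\<^sub>1, \<dots>\<close> is a sequence of unit vectors. Moving one
  digit displaces the sphere in the direction \<open>w\<close> only by \<open>2\<^sup>-\<^sup>j\<^sup>-\<^sup>1 (1 - e\<^sub>j \<bullet> w)\<close>, which is quadratic in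
  \<open>w - e\<^sub>j\<close>. Hence if \<open>e\<^sub>k, e\<^sub>k\<^sub>+\<^sub>1, \<dots>\<close> stay \<open>\<eta>\<close>-close to \<open>w\<close> (up to slow geometric growth), all
  spheres that agree in the first \<open>k\<close> digits are, near the direction \<open>w\<close>, within \<open>2\<^sup>-\<^sup>k \<eta>\<^sup>2\<close> of each
  other. The \<open>2\<^sup>k\<close> prefixes then contribute volume \<open>\<eta>\<^sup>2 \<eta>\<^sup>d\<close> for each \<open>k\<close>, in total \<open>n \<eta>\<^sup>d\<^sup>+\<^sup>2\<close>. An
  \<open>\<eta>\<close>-net of the \<open>d\<close>-sphere, traversed along rows, needs only \<open>n \<approx> \<eta>\<^sup>-\<^sup>d\<close> steps, and the
  construction resolves the scale \<open>\<delta> \<approx> 2\<^sup>-\<^sup>n\<close>, so the volume is of order \<open>\<eta>\<^sup>2 \<approx> n\<^sup>-\<^sup>2\<^sup>/\<^sup>d\<close>.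
\<close>

subsection \<open>Volume of thin conical shells\<close>

lemma power_diff_le:
  fixes x y M :: real
  assumes "0 \<le> x" "x \<le> y" "y \<le> M" "1 \<le> M"
  shows "y ^ n - x ^ n \<le> n * M ^ n * (y - x)"
proof (induction n)
  case (Suc n)
  have "y ^ Suc n - x ^ Suc n = y * (y ^ n - x ^ n) + x ^ n * (y - x)"
    by (simp add: algebra_simps)
  also have "\<dots> \<le> M * (n * M ^ n * (y - x)) + M ^ Suc n * (y - x)"
  proof (intro add_mono mult_mono Suc.IH)
    show "x ^ n \<le> M ^ Suc n"
      using assms power_mono[of x M n] power_increasing[of n "Suc n" M] by linarith
  qed (use assms in \<open>auto intro: power_mono\<close>)
  finally show ?case
    by (simp add: algebra_simps)
qed simp

text \<open>The cone of points whose direction lies within \<open>b\<close> of \<open>e\<close>,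
  with the division by \<open>norm y\<close> cleared: closedness then follows from continuity alone,
  and 0 belongs to it.\<close>

definition dir_cone :: "'a::real_normed_vector \<Rightarrow> real \<Rightarrow> 'a set" where
  "dir_cone e b = {y. norm (y - norm y *\<^sub>R e) \<le> b * norm y}"

lemma closed_dir_cone: "closed (dir_cone e b)"
  unfolding dir_cone_def by (intro closed_Collect_le continuous_intros)

lemma dir_cone_scale:
  assumes "y \<in> dir_cone e b" "0 \<le> t"
  shows "t *\<^sub>R y \<in> dir_cone e b"
proof -
  have "t *\<^sub>R y - norm (t *\<^sub>R y) *\<^sub>R e = t *\<^sub>R (y - norm y *\<^sub>R e)"
    using assms(2) by (simp add: algebra_simps)
  then show ?thesis
    using assms by (simp add: dir_cone_def mult.left_commute[of b t] mult_left_mono)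
qed

lemma lmeasurable_cball_dir_cone: "cball 0 t \<inter> dir_cone e b \<in> lmeasurable"
  for e :: "'a::euclidean_space"
  by (intro lmeasurable_compact compact_Int_closed closed_dir_cone compact_cball)

lemma measure_cball_dir_cone_scale:
  fixes e :: "'a::euclidean_space"
  assumes "0 < t"
  shows "measure lebesgue (cball 0 t \<inter> dir_cone e b) = t ^ DIM('a) * measure lebesgue (cball 0 1 \<inter> dir_cone e b)"
proof -
  have "cball 0 t \<inter> dir_cone e b = (\<lambda>x. t *\<^sub>R x + 0) ` (cball 0 1 \<inter> dir_cone e b)"
  proof (intro equalityI subsetI)
    fix x assume "x \<in> cball 0 t \<inter> dir_cone e b"
    then have "(1 / t) *\<^sub>R x \<in> cball 0 1 \<inter> dir_cone e b"
      using assms by (auto intro!: dir_cone_scale)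
    then show "x \<in> (\<lambda>x. t *\<^sub>R x + 0) ` (cball 0 1 \<inter> dir_cone e b)"
      using assms by (intro image_eqI[of _ _ "(1 / t) *\<^sub>R x"]) auto
  qed (use assms in \<open>auto intro!: dir_cone_scale\<close>)
  then show ?thesis
    using measure_lebesgue_affine[of t 0 "cball 0 1 \<inter> dir_cone e b"] assms by simp
qed

lemma measure_cball_lebesgue:
  "0 \<le> r \<Longrightarrow> measure lebesgue (cball c r :: 'a::euclidean_space set) = unit_ball_vol DIM('a) * r ^ DIM('a)"
  using content_cball[of r c] by simp

text \<open>A point of the cone at distance s from 0 lies within \<open>b\<close> of the axis point
  at distance s. Rounding s down to a multiple of \<open>b\<close> costs another \<open>b\<close>,
  so about \<open>1 / b\<close> balls of radius \<open>2 * b\<close> along the axis cover the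
  truncated cone.\<close>

lemma measure_unit_dir_cone_le:
  fixes e :: "'a::euclidean_space"
  assumes "0 < b" "b \<le> 1" "norm e = 1"
  shows "measure lebesgue (cball 0 1 \<inter> dir_cone e b)
    \<le> 2 ^ (DIM('a) + 1) * unit_ball_vol DIM('a) * b ^ (DIM('a) - 1)"
proof -
  define m where "m = nat \<lfloor>1 / b\<rfloor>"
  let ?B = "\<lambda>i. cball ((of_nat i * b) *\<^sub>R e) (2 * b) :: 'a set"
  have cover: "cball 0 1 \<inter> dir_cone e b \<subseteq> (\<Union>i\<in>{..m}. ?B i)"
  proof
    fix y assume y: "y \<in> cball 0 1 \<inter> dir_cone e b"
    define i where "i = nat \<lfloor>norm y / b\<rfloor>"
    have "norm y / b \<le> 1 / b"
      using y assms by (simp add: divide_right_mono)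
    then have im: "i \<le> m"
      unfolding i_def m_def by (intro nat_mono floor_mono)
    have "0 \<le> norm y / b"
      using assms by simp
    then have "real i \<le> norm y / b" "norm y / b \<le> real i + 1"
      unfolding i_def by linarith+
    then have "real i * b \<le> norm y" "norm y \<le> real i * b + b"
      using assms by (simp_all add: field_simps)
    then have 1: "norm ((norm y - real i * b) *\<^sub>R e) \<le> b"
      using assms by simp
    have "b * norm y \<le> b"
      using y assms by (simp add: mult_left_le)
    then have 2: "norm (y - norm y *\<^sub>R e) \<le> b"
      using y by (simp add: dir_cone_def)
    have "y - (real i * b) *\<^sub>R e = (y - norm y *\<^sub>R e) + (norm y - real i * b) *\<^sub>R e"
      by (simp add: algebra_simps)
    then have "norm (y - (real i * b) *\<^sub>R e) \<le> b + b"
      using norm_triangle_mono[OF 2 1] by metis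
    then show "y \<in> (\<Union>i\<in>{..m}. ?B i)"
      using im by (auto simp: dist_norm norm_minus_commute)
  qed
  have "DIM('a) = Suc (DIM('a) - 1)"
    using DIM_positive[where 'a='a] by simp
  then have N: "b ^ DIM('a) = b * b ^ (DIM('a) - 1)"
    by (metis power_Suc)
  have "measure lebesgue (cball 0 1 \<inter> dir_cone e b) \<le> measure lebesgue (\<Union>i\<in>{..m}. ?B i)"
    using cover by (intro measure_mono_fmeasurable fmeasurableD lmeasurable_cball_dir_cone) auto
  also have "\<dots> \<le> (\<Sum>i\<in>{..m}. measure lebesgue (?B i))"
    by (intro measure_UNION_le) auto
  also have "\<dots> = (real m + 1) * (unit_ball_vol DIM('a) * (2 * b) ^ DIM('a))"
    using assms by (simp add: measure_cball_lebesgue del: measure_completion)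
  also have "\<dots> \<le> (2 / b) * (unit_ball_vol DIM('a) * (2 * b) ^ DIM('a))"
  proof (intro mult_right_mono mult_nonneg_nonneg)
    have "real m \<le> 1 / b"
      using assms by (simp add: m_def)
    moreover have "1 \<le> 1 / b"
      using assms by simp
    ultimately show "real m + 1 \<le> 2 / b"
      by linarith
  qed (use assms in auto)
  also have "\<dots> = 2 ^ (DIM('a) + 1) * unit_ball_vol DIM('a) * b ^ (DIM('a) - 1)"
    using assms by (simp add: power_mult_distrib N)
  finally show ?thesis .
qed

text \<open>By homogeneity the volume is \<open>(r + a) ^ DIM('a) - (r - a) ^ DIM('a)\<close> times
  that of the unit cone. The lower radial bound is strict so that the shell is exactly a difference
  of two closed truncated cones.\<close>

lemma measure_shell_dir_cone_le:
  fixes e c :: "'a::euclidean_space"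
  assumes "0 < b" "b \<le> 1" "norm e = 1" "0 \<le> a" "a < r" "r + a \<le> 3"
  defines "S \<equiv> {x. x - c \<in> dir_cone e b \<and> r - a < norm (x - c) \<and> norm (x - c) \<le> r + a}"
  shows "S \<in> lmeasurable"
    and "measure lebesgue S \<le>
      (2 * DIM('a) * 3 ^ DIM('a) * 2 ^ (DIM('a) + 1) * unit_ball_vol DIM('a)) * a * b ^ (DIM('a) - 1)"
proof -
  let ?S = "cball 0 (r + a) \<inter> dir_cone e b - cball 0 (r - a) \<inter> dir_cone e b"
  let ?V = "measure lebesgue (cball 0 1 \<inter> dir_cone e b)"
  have S: "S = (+) c ` ?S"
  proof (intro equalityI subsetI)
    fix x assume "x \<in> S"
    then show "x \<in> (+) c ` ?S"
      by (intro image_eqI[of _ _ "x - c"]) (auto simp: S_def)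
  qed (auto simp: S_def)
  have "?S \<in> lmeasurable"
    by (intro fmeasurable.Diff lmeasurable_cball_dir_cone)
  then show "S \<in> lmeasurable"
    unfolding S by (simp add: measurable_translation)
  have "measure lebesgue S = measure lebesgue ?S"
    unfolding S by (rule measure_translation)
  also have "\<dots> = measure lebesgue (cball 0 (r + a) \<inter> dir_cone e b) - measure lebesgue (cball 0 (r - a) \<inter> dir_cone e b)"
    using assms by (intro measurable_measure_Diff lmeasurable_cball_dir_cone fmeasurableD) auto
  also have "\<dots> = ((r + a) ^ DIM('a) - (r - a) ^ DIM('a)) * ?V"
    using assms measure_cball_dir_cone_scale[of "r + a" e b] measure_cball_dir_cone_scale[of "r - a" e b]
    by (simp only: left_diff_distrib)
  also have "\<dots> \<le> (DIM('a) * 3 ^ DIM('a) * ((r + a) - (r - a))) * ?V"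
    using assms power_diff_le[of "r - a" "r + a" 3 "DIM('a)"] by (intro mult_right_mono) auto
  also have "\<dots> \<le> (DIM('a) * 3 ^ DIM('a) * ((r + a) - (r - a))) *
      (2 ^ (DIM('a) + 1) * unit_ball_vol DIM('a) * b ^ (DIM('a) - 1))"
    using assms by (intro mult_left_mono measure_unit_dir_cone_le) auto
  finally show "measure lebesgue S \<le>
      (2 * DIM('a) * 3 ^ DIM('a) * 2 ^ (DIM('a) + 1) * unit_ball_vol DIM('a)) * a * b ^ (DIM('a) - 1)"
    by (simp add: algebra_simps)
qed

subsection \<open>Digit expansions\<close>

definition digit_radius :: "nat set \<Rightarrow> real" where
  "digit_radius A = 1 + (\<Sum>j\<in>A. (1/2) ^ Suc j)"

definition digit_center :: "(nat \<Rightarrow> 'a::real_vector) \<Rightarrow> nat set \<Rightarrow> 'a" where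
  "digit_center e A = - (\<Sum>j\<in>A. (1/2) ^ Suc j *\<^sub>R e j)"

text \<open>Greedy binary expansion of \<open>r - 1\<close>: digit \<open>n\<close> is taken when
  the remainder exceeds half of the allowed gap \<open>(1/2) ^ n\<close>.\<close>

lemma digit_radius_expansion:
  assumes "1 \<le> r" "r \<le> 2"
  shows "\<exists>A\<subseteq>{..<n}. digit_radius A \<le> r \<and> r \<le> digit_radius A + (1/2) ^ n"
proof (induction n)
  case 0
  then show ?case using assms by (auto simp: digit_radius_def)
next
  case (Suc n)
  then obtain A where A: "A \<subseteq> {..<n}" "digit_radius A \<le> r" "r \<le> digit_radius A + (1/2) ^ n"
    by blast
  have "finite A" "n \<notin> A"
    using A(1) finite_subset by auto
  then have ins: "digit_radius (insert n A) = digit_radius A + (1/2) ^ Suc n"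
    by (simp add: digit_radius_def)
  show ?case
  proof (cases "r \<le> digit_radius A + (1/2) ^ Suc n")
    case True
    then show ?thesis using A by (intro exI[of _ A]) auto
  next
    case False
    then show ?thesis using A ins by (intro exI[of _ "insert n A"]) auto
  qed
qed

lemma digit_radius_ge: "1 \<le> digit_radius A"
  by (simp add: digit_radius_def sum_nonneg)

lemma digit_radius_le:
  assumes "A \<subseteq> {..<n}"
  shows "digit_radius A \<le> 2"
proof -
  have "(\<Sum>j\<in>A. (1/2) ^ Suc j :: real) \<le> (\<Sum>j<n. (1/2) ^ Suc j)"
    using assms by (intro sum_mono2) auto
  also have "\<dots> = 1 - (1/2) ^ n"
    by (induction n) (auto simp: field_simps)
  also have "\<dots> \<le> 1"
    by simp
  finally show ?thesis
    by (simp add: digit_radius_def)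
qed

lemma digit_tail_sum_le:
  fixes q :: real
  assumes "A \<subseteq> {k..<n}" "0 \<le> c" "0 \<le> q" "q < 2" and f: "\<And>j. j \<in> A \<Longrightarrow> f j \<le> c * q ^ (j - k)"
  shows "(\<Sum>j\<in>A. (1/2) ^ Suc j * f j) \<le> (1/2) ^ k * c / (2 - q)"
proof -
  have "(\<Sum>j\<in>A. (1/2) ^ Suc j * f j) \<le> (\<Sum>j\<in>A. (1/2) ^ Suc j * (c * q ^ (j - k)))"
    by (intro sum_mono mult_left_mono f) auto
  also have "\<dots> \<le> (\<Sum>j\<in>{k..<n}. (1/2) ^ Suc j * (c * q ^ (j - k)))"
    using assms by (intro sum_mono2) auto
  \<comment> \<open>Lengthening the range lets the reindexed sum run over \<open>i < n\<close>
    instead of \<open>i < n - k\<close>.\<close>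
  also have "\<dots> \<le> (\<Sum>j\<in>{k..<k+n}. (1/2) ^ Suc j * (c * q ^ (j - k)))"
    using assms by (intro sum_mono2) auto
  also have "\<dots> = (\<Sum>i<n. (1/2) ^ Suc k * c * (q / 2) ^ i)"
    by (rule sum.reindex_bij_witness[of _ "\<lambda>i. k + i" "\<lambda>j. j - k"])
      (auto simp: power_divide field_simps simp flip: power_add)
  also have "\<dots> = (1/2) ^ Suc k * c * (\<Sum>i<n. (q / 2) ^ i)"
    by (simp add: sum_distrib_left)
  also have "\<dots> \<le> (1/2) ^ Suc k * c * (1 / (1 - q / 2))"
  proof (intro mult_left_mono)
    show "(\<Sum>i<n. (q / 2) ^ i) \<le> 1 / (1 - q / 2)"
      using sum_le_suminf[OF summable_geometric[of "q / 2"], of "{..<n}"] assms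
      by (simp add: suminf_geometric)
  qed (use assms in auto)
  also have "\<dots> = (1/2) ^ k * c / (2 - q)"
    using assms by (simp add: field_simps)
  finally show ?thesis .
qed

text \<open>Seen from the centre of the prefix, the point is \<open>r *\<^sub>R w + t\<close>, where
  \<open>t\<close> collects the radius error and the tail digits. The length of \<open>t\<close> is
  of first order in \<eta>, which suffices for the cone; its component along \<open>w\<close> is of
  second order, which gives the thin shell.\<close>

lemma prefix_shell_approx:
  fixes e :: "nat \<Rightarrow> 'a::real_inner"
  assumes unit: "\<And>j. j < n \<Longrightarrow> norm (e j) = 1" and A: "A \<subseteq> {..<n}" and k: "k < n"
    and \<eta>: "0 < \<eta>" "\<eta> \<le> 1/17" and w: "norm w = 1"
    and near: "\<And>j. \<lbrakk>k \<le> j; j < n\<rbrakk> \<Longrightarrow> norm (w - e j) \<le> \<eta> * (5/4) ^ (j - k)"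
    and n: "(1/2) ^ n \<le> \<eta>\<^sup>2 * (1/2) ^ k"
    and \<rho>: "\<bar>\<rho> - digit_radius A\<bar> \<le> 2 * (1/2) ^ n"
  defines "y \<equiv> digit_center e A + \<rho> *\<^sub>R w - digit_center e (A \<inter> {..<k})"
    and "r \<equiv> digit_radius (A \<inter> {..<k})"
    and "a \<equiv> 32 * (1/2) ^ k * \<eta>\<^sup>2"
  shows "y \<in> dir_cone (e k) (8 * \<eta>) \<and> r - a < norm y \<and> norm y \<le> r + a"
proof -
  define h :: real where "h = (1/2) ^ k"
  have h: "0 < h" "h \<le> 1"
    by (auto simp: h_def power_le_one)
  define T where "T = A - {..<k}"
  have T: "T \<subseteq> {k..<n}"
    using A by (auto simp: T_def)
  have fin: "finite A"
    using A finite_subset by blast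
  define t where "t = (\<rho> - digit_radius A) *\<^sub>R w + (\<Sum>j\<in>T. (1/2) ^ Suc j *\<^sub>R (w - e j))"
  have split: "sum f A = sum f (A \<inter> {..<k}) + sum f T" for f :: "nat \<Rightarrow> 'b::comm_monoid_add"
    unfolding T_def using sum.Int_Diff[OF fin] by blast
  let ?q = "\<lambda>j. (1/2) ^ Suc j :: real"
  have "digit_center e A = digit_center e (A \<inter> {..<k}) - (\<Sum>j\<in>T. ?q j *\<^sub>R e j)"
    unfolding digit_center_def split by (simp only: minus_add_distrib diff_conv_add_uminus)
  moreover have "digit_radius A = r + (\<Sum>j\<in>T. ?q j)"
    unfolding digit_radius_def r_def split by (rule add.assoc[symmetric])
  moreover have "(\<Sum>j\<in>T. ?q j *\<^sub>R (w - e j)) = (\<Sum>j\<in>T. ?q j) *\<^sub>R w - (\<Sum>j\<in>T. ?q j *\<^sub>R e j)"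
    by (simp only: scaleR_diff_right sum_subtractf scaleR_sum_left)
  ultimately have y: "y = r *\<^sub>R w + t"
    unfolding y_def t_def by (simp only: scaleR_add_left scaleR_diff_left) simp
  have r: "1 \<le> r" "r \<le> 2"
    unfolding r_def using digit_radius_ge digit_radius_le[of "A \<inter> {..<k}" k] by auto
  have \<rho>': "\<bar>\<rho> - digit_radius A\<bar> \<le> 2 * h * \<eta>\<^sup>2"
    using \<rho> n by (simp add: h_def mult_ac)
  have \<eta>2: "\<eta>\<^sup>2 \<le> \<eta> / 17"
    using \<eta> mult_left_mono[of \<eta> "1/17" \<eta>] by (simp add: power2_eq_square)
  have "norm t \<le> \<bar>\<rho> - digit_radius A\<bar> + (\<Sum>j\<in>T. (1/2) ^ Suc j * norm (w - e j))"
    unfolding t_def using w by (intro norm_triangle_mono sum_norm_le) auto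
  also have "\<dots> \<le> 2 * h * \<eta>\<^sup>2 + h * \<eta> / (2 - 5/4)"
    unfolding h_def using T near \<eta> \<rho>'[unfolded h_def] by (intro add_mono digit_tail_sum_le[OF T]) auto
  also have "\<dots> \<le> 2 * h * (\<eta> / 17) + h * \<eta> / (2 - 5/4)"
    using h by (intro add_right_mono mult_left_mono \<eta>2) auto
  also have "\<dots> \<le> 2 * h * \<eta>"
    using h \<eta> by (simp add: field_simps)
  finally have t: "norm t \<le> 2 * h * \<eta>" .
  \<comment> \<open>This identity for unit vectors is the gain from first to second order.\<close>
  have inner: "w \<bullet> (w - e j) = (norm (w - e j))\<^sup>2 / 2" if "j \<in> T" for j
  proof -
    have "norm (e j) = 1"
      using that T unit by auto
    then show ?thesis
      using w by (simp add: power2_norm_eq_inner inner_diff inner_commute norm_eq_1)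
  qed
  have "w \<bullet> t = (\<rho> - digit_radius A) + (\<Sum>j\<in>T. (1/2) ^ Suc j * ((norm (w - e j))\<^sup>2 / 2))"
  proof -
    have "w \<bullet> t = (\<rho> - digit_radius A) + (\<Sum>j\<in>T. ?q j * (w \<bullet> (w - e j)))"
      unfolding t_def using w by (simp add: inner_add_right inner_sum_right norm_eq_1 del: power_Suc)
    also have "(\<Sum>j\<in>T. ?q j * (w \<bullet> (w - e j))) = (\<Sum>j\<in>T. ?q j * ((norm (w - e j))\<^sup>2 / 2))"
      by (intro sum.cong refl) (simp only: inner)
    finally show ?thesis .
  qed
  moreover have "0 \<le> (\<Sum>j\<in>T. (1/2) ^ Suc j * ((norm (w - e j))\<^sup>2 / 2))"
    by (intro sum_nonneg) auto
  moreover have "(\<Sum>j\<in>T. (1/2) ^ Suc j * ((norm (w - e j))\<^sup>2 / 2)) \<le> (1/2) ^ k * (\<eta>\<^sup>2 / 2) / (2 - 25/16)"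
  proof (intro digit_tail_sum_le[OF T])
    fix j assume "j \<in> T"
    then have "(norm (w - e j))\<^sup>2 \<le> (\<eta> * (5/4) ^ (j - k))\<^sup>2"
      using T near by (intro power_mono) auto
    also have "\<dots> = \<eta>\<^sup>2 * (25/16) ^ (j - k)"
    proof -
      have "((5/4) ^ (j - k))\<^sup>2 = (25/16 :: real) ^ (j - k)"
        unfolding power2_eq_square power_mult_distrib[symmetric] by simp
      then show ?thesis
        by (simp add: power_mult_distrib)
    qed
    finally show "(norm (w - e j))\<^sup>2 / 2 \<le> \<eta>\<^sup>2 / 2 * (25/16) ^ (j - k)"
      by simp
  qed auto
  moreover have "(1/2) ^ k * (\<eta>\<^sup>2 / 2) / (2 - 25/16) = 8/7 * (h * \<eta>\<^sup>2)"
    by (simp add: h_def)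
  moreover have "0 \<le> h * \<eta>\<^sup>2"
    using h by simp
  ultimately have wt: "\<bar>w \<bullet> t\<bar> \<le> 4 * (h * \<eta>\<^sup>2)"
    using \<rho>' by linarith
  define s where "s = norm y"
  have s0: "0 \<le> s"
    by (simp add: s_def)
  \<comment> \<open>Squares are compared first; \<open>s + r\<close> is at least 1, so the bound
    passes to the difference of \<open>s\<close> and \<open>r\<close>.\<close>
  have "s\<^sup>2 - r\<^sup>2 = 2 * r * (w \<bullet> t) + (norm t)\<^sup>2"
    unfolding s_def y power2_norm_eq_inner using w
    by (simp add: inner_add inner_commute norm_eq_1 algebra_simps power2_eq_square)
  moreover have "\<bar>2 * r * (w \<bullet> t)\<bar> \<le> 4 * (4 * (h * \<eta>\<^sup>2))"
    unfolding abs_mult using r wt by (intro mult_mono) auto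
  moreover have "(norm t)\<^sup>2 \<le> (2 * h * \<eta>)\<^sup>2"
    using t by (intro power_mono) auto
  moreover have "(2 * h * \<eta>)\<^sup>2 \<le> 4 * (h * \<eta>\<^sup>2)"
    using h mult_right_mono[of "h * h" h "\<eta>\<^sup>2"] by (simp add: power2_eq_square mult_ac)
  ultimately have "\<bar>s\<^sup>2 - r\<^sup>2\<bar> \<le> 20 * (h * \<eta>\<^sup>2)"
    by (smt (verit) zero_le_power2)
  moreover have "\<bar>s - r\<bar> * 1 \<le> \<bar>s - r\<bar> * (s + r)"
    using r s0 by (intro mult_left_mono) auto
  moreover have "\<bar>s - r\<bar> * (s + r) = \<bar>s\<^sup>2 - r\<^sup>2\<bar>"
    using r s0 by (simp add: power2_eq_square square_diff_square_factored abs_mult mult.commute)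
  ultimately have sr: "\<bar>s - r\<bar> \<le> 20 * (h * \<eta>\<^sup>2)"
    by simp
  have "h * \<eta>\<^sup>2 \<le> 1 * (\<eta> / 17)"
    using h \<eta> \<eta>2 by (intro mult_mono) auto
  then have h\<eta>: "h * \<eta>\<^sup>2 \<le> \<eta> / 17" and s: "1/2 \<le> s"
    using sr r \<eta> by auto
  have "y - s *\<^sub>R e k = t + (r - s) *\<^sub>R w + s *\<^sub>R (w - e k)"
    by (simp add: y algebra_simps)
  also have "norm (t + (r - s) *\<^sub>R w + s *\<^sub>R (w - e k)) \<le> 2 * h * \<eta> + \<bar>r - s\<bar> + s * \<eta>"
    using t w s near[of k] k by (intro norm_triangle_mono) (auto simp: mult_left_mono)
  finally have "norm (y - s *\<^sub>R e k) \<le> 2 * h * \<eta> + \<bar>r - s\<bar> + s * \<eta>" .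
  moreover have "2 * h * \<eta> \<le> 2 * \<eta>"
    using h \<eta> by simp
  moreover have "1/2 * \<eta> \<le> s * \<eta>"
    using s \<eta> by (intro mult_right_mono) auto
  \<comment> \<open>Since \<open>\<eta> \<le> 2 * s * \<eta>\<close>, the three terms sum to at most
    \<open>(4 + 40/17 + 1) * s * \<eta>\<close>; hence the 8.\<close>
  ultimately have "norm (y - s *\<^sub>R e k) \<le> 8 * (s * \<eta>)"
    using sr h\<eta> by linarith
  then have "y \<in> dir_cone (e k) (8 * \<eta>)"
    by (simp add: dir_cone_def s_def mult_ac)
  \<comment> \<open>Positivity makes \<open>20 * (h * \<eta>\<^sup>2)\<close> strictly less than
    \<open>a\<close>, as the strict lower radial bound demands.\<close>
  moreover have "0 < h * \<eta>\<^sup>2"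
    using h \<eta> by simp
  ultimately show ?thesis
    using sr by (simp add: s_def a_def h_def abs_le_iff)
qed

subsection \<open>The union of shells\<close>

text \<open>
  The rate \<open>5/4\<close> is chosen so that even its square is below 2: both the first and the second
  moments of \<open>w - e\<^sub>j\<close> against the weights \<open>2\<^sup>-\<^sup>j\<close> are then geometric sums.
\<close>

definition follows :: "real \<Rightarrow> nat \<Rightarrow> (nat \<Rightarrow> 'a::real_normed_vector) \<Rightarrow> bool" where
  "follows \<eta> n e \<longleftrightarrow> (\<forall>j<n. norm (e j) = 1) \<and>
    (\<forall>w. norm w = 1 \<longrightarrow> (\<exists>k<n. (1/2) ^ n \<le> \<eta>\<^sup>2 * (1/2) ^ k \<and>
      (\<forall>j. k \<le> j \<and> j < n \<longrightarrow> norm (w - e j) \<le> \<eta> * (5/4) ^ (j - k))))"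

text \<open>There are finitely many digit radii; thickening each sphere outward by
  \<open>(1/2) ^ n\<close> catches the remaining radii without new centres and keeps the union
  compact.\<close>

definition shells :: "nat \<Rightarrow> (nat \<Rightarrow> 'a::real_normed_vector) \<Rightarrow> 'a set" where
  "shells n e = (\<Union>A\<in>Pow {..<n}.
    {x. digit_radius A \<le> norm (x - digit_center e A) \<and>
        norm (x - digit_center e A) \<le> digit_radius A + (1/2) ^ n})"

lemma compact_shells: "compact (shells n e)"
  for e :: "nat \<Rightarrow> 'a::euclidean_space"
  unfolding shells_def
proof (intro compact_UN)
  fix A :: "nat set"
  let ?c = "digit_center e A" and ?r = "digit_radius A"
  have "{x. ?r \<le> norm (x - ?c) \<and> norm (x - ?c) \<le> ?r + (1/2) ^ n}
      = cball ?c (?r + (1/2) ^ n) \<inter> {x. ?r \<le> norm (x - ?c)}"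
    by (auto simp: dist_norm norm_minus_commute)
  moreover have "closed {x. ?r \<le> norm (x - ?c)}"
    by (intro closed_Collect_le continuous_intros)
  ultimately show "compact {x. ?r \<le> norm (x - ?c) \<and> norm (x - ?c) \<le> ?r + (1/2) ^ n}"
    by (simp add: compact_Int_closed)
qed simp

lemma sphere_subset_shells:
  assumes "1 \<le> r" "r \<le> 2"
  shows "\<exists>c. sphere c r \<subseteq> shells n e"
proof -
  obtain A where "A \<subseteq> {..<n}" "digit_radius A \<le> r" "r \<le> digit_radius A + (1/2) ^ n"
    using digit_radius_expansion[OF assms] by blast
  then have "sphere (digit_center e A) r \<subseteq> shells n e"
    by (auto simp: shells_def dist_norm norm_minus_commute)
  then show ?thesis ..
qed

lemma open_nbhd: "open (nbhd \<delta> S)"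
proof -
  have "nbhd \<delta> S = (\<Union>y\<in>S. ball y \<delta>)"
    by (auto simp: nbhd_def dist_commute)
  then show ?thesis
    by (simp add: open_UN)
qed

text \<open>The index \<open>k\<close> is chosen from the direction \<open>w\<close> alone, and only
  the first \<open>k\<close> digits of \<open>A\<close> survive. This compresses the
  \<open>2 ^ n\<close> shells to \<open>2 ^ k\<close> near the direction \<open>e k\<close>.\<close>

lemma nbhd_shells_subset:
  fixes e :: "nat \<Rightarrow> 'a::euclidean_space"
  assumes e: "follows \<eta> n e" and \<eta>: "0 < \<eta>" "\<eta> \<le> 1/17" and \<delta>: "\<delta> \<le> (1/2) ^ n"
  shows "nbhd \<delta> (shells n e) \<subseteq> (\<Union>k<n. \<Union>B\<in>Pow {..<k}.
    {x. x - digit_center e B \<in> dir_cone (e k) (8 * \<eta>) \<and>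
        digit_radius B - 32 * (1/2) ^ k * \<eta>\<^sup>2 < norm (x - digit_center e B) \<and>
        norm (x - digit_center e B) \<le> digit_radius B + 32 * (1/2) ^ k * \<eta>\<^sup>2})"
proof
  fix x assume "x \<in> nbhd \<delta> (shells n e)"
  then obtain z A where A: "A \<subseteq> {..<n}" and xz: "dist x z < \<delta>"
    and z: "digit_radius A \<le> norm (z - digit_center e A)"
      "norm (z - digit_center e A) \<le> digit_radius A + (1/2) ^ n"
    by (auto simp: nbhd_def shells_def)
  define \<rho> where "\<rho> = norm (x - digit_center e A)"
  have "\<bar>\<rho> - norm (z - digit_center e A)\<bar> \<le> dist x z"
    unfolding \<rho>_def dist_norm using norm_triangle_ineq3[of "x - digit_center e A" "z - digit_center e A"]
    by simp
  \<comment> \<open>One \<open>(1/2) ^ n\<close> is the thickness of the shell, the other bounds the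
    radius of the neighbourhood.\<close>
  then have \<rho>: "\<bar>\<rho> - digit_radius A\<bar> \<le> 2 * (1/2) ^ n"
    using z xz \<delta> by linarith
  obtain w where w: "norm w = 1" and x: "x = digit_center e A + \<rho> *\<^sub>R w"
  proof (cases "\<rho> = 0")
    \<comment> \<open>At the centre itself every direction works, so some basis vector is
      taken.\<close>
    case True
    then show ?thesis
      using that[of "SOME b. b \<in> Basis"] by (simp add: \<rho>_def SOME_Basis)
  next
    case False
    then show ?thesis
      using that[of "(1 / \<rho>) *\<^sub>R (x - digit_center e A)"] by (auto simp: \<rho>_def)
  qed
  obtain k where "k < n" "(1/2) ^ n \<le> \<eta>\<^sup>2 * (1/2) ^ k"
      "\<And>j. \<lbrakk>k \<le> j; j < n\<rbrakk> \<Longrightarrow> norm (w - e j) \<le> \<eta> * (5/4) ^ (j - k)"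
    using e w unfolding follows_def by blast
  moreover have "\<And>j. j < n \<Longrightarrow> norm (e j) = 1"
    using e by (simp add: follows_def)
  ultimately show "x \<in> (\<Union>k<n. \<Union>B\<in>Pow {..<k}.
    {x. x - digit_center e B \<in> dir_cone (e k) (8 * \<eta>) \<and>
        digit_radius B - 32 * (1/2) ^ k * \<eta>\<^sup>2 < norm (x - digit_center e B) \<and>
        norm (x - digit_center e B) \<le> digit_radius B + 32 * (1/2) ^ k * \<eta>\<^sup>2})"
    using prefix_shell_approx[of n e A k \<eta> w \<rho>] A \<eta> w \<rho> unfolding x[symmetric]
    by (intro UN_I[of k] UN_I[of "A \<inter> {..<k}"]) auto
qed

text \<open>The \<open>2 ^ k\<close> prefixes of length \<open>k\<close> give shells of thickness
  proportional to \<open>(1/2) ^ k\<close>; the powers cancel and each \<open>k\<close> contributes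
  the same amount.\<close>

lemma measure_nbhd_shells_le:
  fixes e :: "nat \<Rightarrow> 'a::euclidean_space"
  assumes e: "follows \<eta> n e" and \<eta>: "0 < \<eta>" "\<eta> \<le> 1/17" and \<delta>: "\<delta> \<le> (1/2) ^ n"
  defines "V \<equiv> 2 * DIM('a) * 3 ^ DIM('a) * 2 ^ (DIM('a) + 1) * unit_ball_vol DIM('a)"
  shows "measure lebesgue (nbhd \<delta> (shells n e)) \<le> V * 32 * 8 ^ (DIM('a) - 1) * n * \<eta> ^ (DIM('a) + 1)"
proof -
  define a where "a = (\<lambda>k. 32 * (1/2) ^ k * \<eta>\<^sup>2)"
  define S where "S = (\<lambda>k B. {x. x - digit_center e B \<in> dir_cone (e k) (8 * \<eta>) \<and>
        digit_radius B - a k < norm (x - digit_center e B) \<and>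
        norm (x - digit_center e B) \<le> digit_radius B + a k})"
  define v where "v = (\<lambda>k. V * a k * (8 * \<eta>) ^ (DIM('a) - 1))"
  have S: "S k B \<in> lmeasurable \<and> measure lebesgue (S k B) \<le> v k" if "k < n" "B \<in> Pow {..<k}" for k B
  proof -
    \<comment> \<open>This keeps \<open>a k\<close> below 1, so shells around radii between 1 and 2
      meet the conditions \<open>a < r\<close> and \<open>r + a \<le> 3\<close> of the volume
      bound.\<close>
    have "\<eta>\<^sup>2 \<le> (1/17)\<^sup>2"
      using \<eta> by (intro power_mono) auto
    then have "(1/2) ^ k * \<eta>\<^sup>2 \<le> 1 * (1/17)\<^sup>2"
      by (intro mult_mono) (auto simp: power_le_one)
    then have "a k < 1"
      by (simp add: a_def power2_eq_square)
    moreover have "0 \<le> a k"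
      by (simp add: a_def)
    moreover have "norm (e k) = 1"
      using e that by (simp add: follows_def)
    moreover have "1 \<le> digit_radius B" "digit_radius B \<le> 2"
      using digit_radius_ge digit_radius_le[of B k] that by auto
    ultimately show ?thesis
      unfolding S_def v_def V_def using \<eta> by (intro conjI measure_shell_dir_cone_le) auto
  qed
  have meas: "(\<Union>B\<in>Pow {..<k}. S k B) \<in> lmeasurable" if "k < n" for k
    using S that by (intro fmeasurable.finite_UN) auto
  have "measure lebesgue (nbhd \<delta> (shells n e)) \<le> measure lebesgue (\<Union>k<n. \<Union>B\<in>Pow {..<k}. S k B)"
  proof (intro measure_mono_fmeasurable)
    show "nbhd \<delta> (shells n e) \<subseteq> (\<Union>k<n. \<Union>B\<in>Pow {..<k}. S k B)"
      unfolding S_def a_def by (rule nbhd_shells_subset[OF e \<eta> \<delta>])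
    show "(\<Union>k<n. \<Union>B\<in>Pow {..<k}. S k B) \<in> lmeasurable"
      by (rule fmeasurable.finite_UN) (simp_all add: meas)
  qed (simp add: open_nbhd)
  also have "\<dots> \<le> (\<Sum>k<n. measure lebesgue (\<Union>B\<in>Pow {..<k}. S k B))"
    using meas by (intro measure_UNION_le) auto
  also have "\<dots> \<le> (\<Sum>k<n. \<Sum>B\<in>Pow {..<k}. measure lebesgue (S k B))"
    using S by (intro sum_mono measure_UNION_le) auto
  also have "\<dots> \<le> (\<Sum>k<n. \<Sum>B\<in>Pow {..<k}. v k)"
    using S by (intro sum_mono) auto
  also have "\<dots> = (\<Sum>k<n. V * (32 * \<eta>\<^sup>2) * (8 * \<eta>) ^ (DIM('a) - 1))"
    by (simp add: v_def a_def card_Pow power_divide)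
  also have "\<dots> = V * 32 * 8 ^ (DIM('a) - 1) * n * \<eta> ^ (DIM('a) + 1)"
  proof -
    obtain p where "DIM('a) = Suc p"
      using DIM_positive[where 'a='a] gr0_conv_Suc by blast
    then show ?thesis
      by (simp add: power_mult_distrib power2_eq_square)
  qed
  finally show ?thesis .
qed

subsection \<open>Traversing the sphere\<close>

text \<open>Change the numerator first and the denominator second; each change costs at most
  \<open>norm (a - b)\<close>.\<close>

lemma norm_sgn_diff_le:
  fixes a b :: "'a::real_normed_vector"
  assumes "1 \<le> norm a"
  shows "norm (sgn a - sgn b) \<le> 2 * norm (a - b)"
proof -
  have "sgn a - sgn b = (1 / norm a) *\<^sub>R (a - b) + (1 / norm a - 1 / norm b) *\<^sub>R b"
    by (simp add: sgn_div_norm algebra_simps divide_inverse)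
  moreover have "norm ((1 / norm a) *\<^sub>R (a - b)) \<le> norm (a - b)"
    using assms by (simp add: divide_le_eq mult_le_cancel_left1)
  moreover have "norm ((1 / norm a - 1 / norm b) *\<^sub>R b) \<le> norm (a - b)"
  proof (cases "b = 0")
    case False
    moreover have "norm a \<noteq> 0"
      using assms by linarith
    ultimately have "(1 / norm a - 1 / norm b) * norm b = (norm b - norm a) / norm a"
      by (simp add: field_simps)
    then have "norm ((1 / norm a - 1 / norm b) *\<^sub>R b) = \<bar>norm b - norm a\<bar> / norm a"
      by (metis abs_divide abs_mult abs_norm_cancel norm_scaleR)
    also have "\<dots> \<le> \<bar>norm b - norm a\<bar> / 1"
      using assms by (intro divide_left_mono) auto
    also have "\<dots> \<le> norm (a - b)"
      using norm_triangle_ineq3[of a b] by simp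
    finally show ?thesis .
  qed simp
  ultimately show ?thesis
    using norm_triangle_mono by fastforce
qed

text \<open>
  Rows in the direction \<open>j\<close> on the faces \<open>\<plusminus>i\<close> of the cube of side 2, projected radially to the
  sphere; \<open>f\<close> holds the coordinates of the starting point of a row in units of \<open>1/m\<close>.
\<close>

definition grid_row :: "nat \<Rightarrow> 'a::euclidean_space \<Rightarrow> 'a \<Rightarrow> ('a \<Rightarrow> int) set" where
  "grid_row m i j = (\<Pi>\<^sub>E b\<in>Basis. if b = i then {int m, - int m} else if b = j then {- int m}
    else {- int m..int m})"

lemma card_grid_row_le:
  fixes i j :: "'a::euclidean_space"
  assumes "i \<in> Basis" "j \<in> Basis - {i}" "0 < m"
  shows "finite (grid_row m i j) \<and> card (grid_row m i j) \<le> 2 * (3 * m) ^ (DIM('a) - 2)"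
proof
  show "finite (grid_row m i j)"
    unfolding grid_row_def by (intro finite_PiE) auto
  let ?g = "\<lambda>b. card (if b = i then {int m, - int m} else if b = j then {- int m} else {- int m..int m})"
  have "card (grid_row m i j) = (\<Prod>b\<in>Basis. ?g b)"
    unfolding grid_row_def by (intro card_PiE) simp
  also have "\<dots> = ?g i * (?g j * (\<Prod>b\<in>Basis - {i} - {j}. ?g b))"
    using assms by (subst prod.remove[of _ i], simp, simp) (subst prod.remove[of _ j], auto)
  also have "(\<Prod>b\<in>Basis - {i} - {j}. ?g b) = (\<Prod>b\<in>Basis - {i} - {j}. 2 * m + 1)"
    by (intro prod.cong refl) auto
  also have "\<dots> = (2 * m + 1) ^ (DIM('a) - 2)"
    using assms by (simp add: card_Diff_singleton)
  also have "?g i * (?g j * (2 * m + 1) ^ (DIM('a) - 2)) = 2 * (2 * m + 1) ^ (DIM('a) - 2)"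
    using assms by auto
  also have "\<dots> \<le> 2 * (3 * m) ^ (DIM('a) - 2)"
    using assms by (intro mult_left_mono power_mono) auto
  finally show "card (grid_row m i j) \<le> 2 * (3 * m) ^ (DIM('a) - 2)" .
qed

definition grid_point :: "nat \<Rightarrow> ('a \<Rightarrow> int) \<Rightarrow> 'a::euclidean_space" where
  "grid_point m f = (\<Sum>b\<in>Basis. (of_int (f b) / of_nat m) *\<^sub>R b)"

text \<open>Scaling \<open>w\<close> to the surface of the cube and rounding to the grid moves each
  coordinate by at most \<open>1 / m\<close>; projecting back to the sphere at most doubles the
  total error. The lower bound on \<open>norm (v + t *\<^sub>R j)\<close> makes this projection
  Lipschitz along a row.\<close>

lemma sphere_rows:
  assumes "2 \<le> DIM('a::euclidean_space)" "0 < m"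
  shows "\<exists>R :: ('a \<times> 'a) set. finite R \<and> card R \<le> DIM('a)\<^sup>2 * (2 * (3 * m) ^ (DIM('a) - 2)) \<and>
    (\<forall>(v, j)\<in>R. norm j = 1 \<and> (\<forall>t. 1 \<le> norm (v + t *\<^sub>R j))) \<and>
    (\<forall>w. norm w = 1 \<longrightarrow> (\<exists>(v, j)\<in>R. \<exists>p\<le>2 * m.
      norm (w - sgn (v + (real p / real m) *\<^sub>R j)) \<le> 2 * DIM('a) / m))"
proof -
  let ?R = "\<Union>i\<in>(Basis :: 'a set). \<Union>j\<in>Basis - {i}. (\<lambda>f. (grid_point m f, j)) ` grid_row m i j"
  show ?thesis
  proof (intro exI[of _ ?R] conjI)
    show "finite ?R"
      using card_grid_row_le[OF _ _ assms(2)] by (intro finite_UN_I finite_imageI) auto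
    have "card ?R \<le> (\<Sum>i\<in>(Basis :: 'a set). card (\<Union>j\<in>Basis - {i}. (\<lambda>f. (grid_point m f, j)) ` grid_row m i j))"
      by (intro card_UN_le) simp
    also have "\<dots> \<le> (\<Sum>i\<in>(Basis :: 'a set). \<Sum>j\<in>Basis - {i}. card ((\<lambda>f. (grid_point m f, j)) ` grid_row m i j))"
      by (intro sum_mono card_UN_le) simp
    also have "\<dots> \<le> (\<Sum>i\<in>(Basis :: 'a set). \<Sum>j\<in>Basis - {i}. 2 * (3 * m) ^ (DIM('a) - 2))"
      using card_grid_row_le[OF _ _ assms(2)] by (intro sum_mono order_trans[OF card_image_le]) auto
    also have "\<dots> \<le> DIM('a)\<^sup>2 * (2 * (3 * m) ^ (DIM('a) - 2))"
      by (simp add: card_Diff_singleton power2_eq_square)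
    finally show "card ?R \<le> DIM('a)\<^sup>2 * (2 * (3 * m) ^ (DIM('a) - 2))" .
    have "1 \<le> norm (grid_point m f + t *\<^sub>R j)"
      if i: "i \<in> Basis" and j: "j \<in> Basis" "j \<noteq> i" and f: "f \<in> grid_row m i j" for i j :: 'a and f t
    proof -
      \<comment> \<open>Coordinate \<open>i\<close> stays constant along the row, so the row never
        leaves the plane of its face.\<close>
      have "f i = int m \<or> f i = - int m"
        using PiE_mem[OF f[unfolded grid_row_def] i] by simp
      then have "\<bar>(grid_point m f + t *\<^sub>R j) \<bullet> i\<bar> = 1"
        using i j assms(2) by (auto simp: grid_point_def inner_add_left inner_not_same_Basis)
      then show ?thesis
        using Basis_le_norm[OF i] by metis
    qed
    then show "\<forall>(v, j)\<in>?R. norm j = 1 \<and> (\<forall>t. 1 \<le> norm (v + t *\<^sub>R j))"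
      by auto
    show "\<forall>w. norm w = 1 \<longrightarrow> (\<exists>(v, j)\<in>?R. \<exists>p\<le>2 * m.
      norm (w - sgn (v + (real p / real m) *\<^sub>R j)) \<le> 2 * DIM('a) / m)"
    proof (intro allI impI)
      fix w :: 'a assume w: "norm w = 1"
      define M where "M = Max ((\<lambda>b. \<bar>w \<bullet> b\<bar>) ` Basis)"
      have "M \<in> (\<lambda>b. \<bar>w \<bullet> b\<bar>) ` Basis"
        unfolding M_def by (intro Max_in) auto
      then obtain i where i: "i \<in> Basis" "M = \<bar>w \<bullet> i\<bar>"
        by auto
      have M: "\<bar>w \<bullet> b\<bar> \<le> M" if "b \<in> Basis" for b
        unfolding M_def using that by (intro Max_ge) auto
      have "M \<noteq> 0"
        using w M euclidean_eq_iff[of w 0] by fastforce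
      then have Mpos: "0 < M"
        using i by simp
      define u where "u = (1 / M) *\<^sub>R w"
      have ub: "\<bar>u \<bullet> b\<bar> \<le> 1" if "b \<in> Basis" for b
        using M[OF that] Mpos by (simp add: u_def)
      have ui: "u \<bullet> i = 1 \<or> u \<bullet> i = -1"
        using i Mpos by (auto simp: u_def abs_if split: if_splits)
      have wu: "w = sgn u"
        using w Mpos by (simp add: u_def sgn_div_norm)
      have "card (Basis - {i}) \<noteq> 0"
        using assms i by (simp add: card_Diff_singleton)
      then obtain j where j: "j \<in> Basis" "j \<noteq> i"
        by (metis Diff_iff card.empty ex_in_conv insertI1)
      \<comment> \<open>Rows start at \<open>j\<close>-coordinate -1, hence the shift by 1.\<close>
      define p where "p = nat \<lfloor>m * (u \<bullet> j + 1)\<rfloor>"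
      define f where "f = restrict (\<lambda>b. if b = j then - int m else \<lfloor>m * (u \<bullet> b)\<rfloor>) Basis"
      have rng: "- int m \<le> \<lfloor>m * (u \<bullet> b)\<rfloor> \<and> \<lfloor>m * (u \<bullet> b)\<rfloor> \<le> int m" if "b \<in> Basis" for b
      proof -
        have "\<bar>real m * (u \<bullet> b)\<bar> \<le> real m * 1"
          unfolding abs_mult using ub[OF that] by (intro mult_mono) auto
        then show ?thesis
          by linarith
      qed
      have f: "f \<in> grid_row m i j"
      proof -
        \<comment> \<open>Rounding is exact in coordinate \<open>i\<close>, so the grid point
          remains on the face of \<open>u\<close>.\<close>
        have "\<lfloor>real m * (u \<bullet> i)\<rfloor> = int m \<or> \<lfloor>real m * (u \<bullet> i)\<rfloor> = - int m"
          using ui by (elim disjE; simp) linarith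
        then show ?thesis
          using rng j by (auto simp: grid_row_def f_def)
      qed
      have "real m * (u \<bullet> j + 1) \<le> real m * 2"
        using ub[OF j(1)] by (intro mult_left_mono) auto
      moreover have "0 \<le> real m * (u \<bullet> j + 1)"
        using ub[OF j(1)] by (intro mult_nonneg_nonneg) auto
      ultimately have p: "p \<le> 2 * m" "real p \<le> m * (u \<bullet> j + 1)" "m * (u \<bullet> j + 1) \<le> real p + 1"
        unfolding p_def by linarith+
      let ?z = "grid_point m f + (real p / real m) *\<^sub>R j"
      have close: "\<bar>(u - ?z) \<bullet> b\<bar> \<le> 1 / m" if b: "b \<in> Basis" for b
      proof (cases "b = j")
        case True
        have "(u - ?z) \<bullet> b = (m * (u \<bullet> j + 1) - real p) / m"
          using j assms(2) True
          by (simp add: grid_point_def f_def inner_diff_left inner_add_left field_simps)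
        then show ?thesis
          using p assms(2) by (simp add: divide_right_mono)
      next
        case False
        have "(u - ?z) \<bullet> b = (m * (u \<bullet> b) - \<lfloor>m * (u \<bullet> b)\<rfloor>) / m"
          using b j assms(2) False
          by (simp add: grid_point_def f_def inner_diff_left inner_add_left inner_not_same_Basis field_simps)
        moreover have "\<bar>m * (u \<bullet> b) - \<lfloor>m * (u \<bullet> b)\<rfloor>\<bar> \<le> 1"
          by linarith
        ultimately show ?thesis
          using assms(2) by (simp add: divide_right_mono)
      qed
      have "norm (u - ?z) \<le> (\<Sum>b\<in>Basis. \<bar>(u - ?z) \<bullet> b\<bar>)"
        by (rule norm_le_l1)
      also have "\<dots> \<le> (\<Sum>b\<in>(Basis :: 'a set). 1 / m)"
        by (intro sum_mono close)
      finally have "norm (u - ?z) \<le> DIM('a) / m"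
        by simp
      moreover have "1 \<le> norm u"
        using Basis_le_norm[OF i(1), of u] ui by auto
      ultimately have "norm (w - sgn ?z) \<le> 2 * DIM('a) / m"
        using norm_sgn_diff_le[of u ?z] wu by simp
      then show "\<exists>(v, j)\<in>?R. \<exists>p\<le>2 * m. norm (w - sgn (v + (real p / real m) *\<^sub>R j)) \<le> 2 * DIM('a) / m"
        using i j f p by (intro bexI[of _ "(grid_point m f, j)"]) auto
    qed
  qed
qed

text \<open>
  Each row takes \<open>4 * m\<close> steps, the last \<open>2 * m\<close> of them stationary: by the time the sequence
  jumps to another row, \<open>(5/4) ^ (2 * m)\<close> exceeds \<open>m\<close> up to a constant, which makes the
  requirement on the distance trivial. So no care about the order of the rows is needed.
\<close>

lemma ex_follows:
  assumes N: "2 \<le> DIM('a::euclidean_space)" and m: "0 < m"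
  shows "\<exists>n (e :: nat \<Rightarrow> 'a). follows ((2 * DIM('a) + 8) / m) n e \<and>
    real n \<le> 8 * DIM('a)\<^sup>2 * 3 ^ (DIM('a) - 2) * real m ^ (DIM('a) - 1)"
proof -
  obtain R :: "('a \<times> 'a) set" where R: "finite R" "card R \<le> DIM('a)\<^sup>2 * (2 * (3 * m) ^ (DIM('a) - 2))"
    and row: "\<And>v j. (v, j) \<in> R \<Longrightarrow> norm j = 1" "\<And>v j t. (v, j) \<in> R \<Longrightarrow> 1 \<le> norm (v + t *\<^sub>R j)"
    and cover: "\<And>w. norm w = 1 \<Longrightarrow> \<exists>(v, j)\<in>R. \<exists>p\<le>2 * m.
      norm (w - sgn (v + (real p / real m) *\<^sub>R j)) \<le> 2 * DIM('a) / m"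
    using sphere_rows[OF N m] by blast
  obtain g where g: "bij_betw g {0..<card R} R"
    using ex_bij_betw_nat_finite[OF R(1)] by blast
  \<comment> \<open>The \<open>min\<close> freezes the walk once it reaches the end of the
    row.\<close>
  define pt where "pt = (\<lambda>a p. sgn (fst (g a) + (real (min p (2 * m)) / real m) *\<^sub>R snd (g a)))"
  define e where "e = (\<lambda>k. pt (k div (4 * m)) (k mod (4 * m)))"
  define n where "n = card R * (4 * m)"
  \<comment> \<open>\<open>2 * DIM('a) / m\<close> pays for the grid and \<open>8 / m\<close> for
    the drift: \<open>i\<close> steps cost \<open>2 * (i / m) = (8 / m) * (i * (1/4))\<close>, which
    Bernoulli's inequality absorbs into \<open>(5/4) ^ i\<close>.\<close>
  define \<eta> where "\<eta> = (2 * DIM('a) + 8) / m"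
  have gR: "(fst (g a), snd (g a)) \<in> R" if "a < card R" for a
    using g that bij_betwE by fastforce
  have pt_unit: "norm (pt a p) = 1" if "a < card R" for a p
  proof -
    have "fst (g a) + (real (min p (2 * m)) / real m) *\<^sub>R snd (g a) \<noteq> 0"
      using row(2)[OF gR[OF that], of "real (min p (2 * m)) / real m"] by force
    then show ?thesis
      unfolding pt_def by (simp add: norm_sgn)
  qed
  have pt_lip: "norm (pt a p - pt a (p + i)) \<le> 2 * (i / m)" if "a < card R" for a p i
  proof -
    let ?t = "\<lambda>p. real (min p (2 * m)) / real m"
    have "norm (pt a p - pt a (p + i)) \<le> 2 * norm ((fst (g a) + ?t p *\<^sub>R snd (g a)) - (fst (g a) + ?t (p + i) *\<^sub>R snd (g a)))"
      unfolding pt_def by (intro norm_sgn_diff_le row(2) gR that)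
    also have "\<dots> = 2 * (\<bar>real (min p (2 * m)) - real (min (p + i) (2 * m))\<bar> / m)"
      using row(1)[OF gR[OF that]] by (simp flip: scaleR_left_diff_distrib diff_divide_distrib)
    also have "\<dots> \<le> 2 * (i / m)"
      by (intro mult_left_mono divide_right_mono) auto
    finally show ?thesis .
  qed
  have e_unit: "norm (e k) = 1" if "k < n" for k
    using that m unfolding e_def n_def by (intro pt_unit) (simp add: less_mult_imp_div_less)
  have \<eta>_ge: "8 / m \<le> \<eta>" "2 * DIM('a) / m \<le> \<eta>"
    unfolding \<eta>_def by (intro divide_right_mono; simp)+
  have bern: "1 + i * (1/4) \<le> (5/4 :: real) ^ i" for i :: nat
    using Bernoulli_inequality[of "1/4 :: real" i] by simp
  have cov: "\<exists>k<n. (1/2) ^ n \<le> \<eta>\<^sup>2 * (1/2) ^ k \<and>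
      (\<forall>l. k \<le> l \<and> l < n \<longrightarrow> norm (w - e l) \<le> \<eta> * (5/4) ^ (l - k))" if w: "norm w = 1" for w
  proof -
    obtain v j p where vj: "(v, j) \<in> R" and p: "p \<le> 2 * m"
      and near: "norm (w - sgn (v + (real p / real m) *\<^sub>R j)) \<le> 2 * DIM('a) / m"
      using cover[OF w] by blast
    obtain a where a: "a < card R" "g a = (v, j)"
      using g vj unfolding bij_betw_def by (metis atLeastLessThan_iff imageE)
    define k where "k = a * (4 * m) + p"
    have "(a + 1) * (4 * m) \<le> n"
      unfolding n_def using a by (intro mult_right_mono) auto
    \<comment> \<open>At least \<open>2 * m\<close> steps of the block remain after
      \<open>k\<close>; they supply the factor \<open>\<eta>\<^sup>2\<close> in the resolution
      bound.\<close>
    then have kn: "k + 2 * m \<le> n"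
      using p by (simp add: k_def)
    have ek: "norm (w - pt a p) \<le> 2 * DIM('a) / m"
      using near p a by (simp add: pt_def)
    have "(1/2) ^ n \<le> ((1/2) ^ (k + 2 * m) :: real)"
      using kn by (intro power_decreasing) auto
    also have "\<dots> = ((1/2) ^ m)\<^sup>2 * (1/2) ^ k"
      by (simp add: power_add power_mult mult.commute[of 2])
    also have "\<dots> \<le> \<eta>\<^sup>2 * (1/2) ^ k"
    proof (intro mult_right_mono power_mono)
      have "real m \<le> 2 ^ m"
        using less_exp[of m] by (metis less_imp_le of_nat_le_iff of_nat_numeral of_nat_power)
      then have "(1/2) ^ m \<le> 1 / real m"
        using m by (simp add: power_one_over frac_le)
      also have "\<dots> \<le> 8 / m"
        by (intro divide_right_mono) auto
      finally show "(1/2) ^ m \<le> \<eta>"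
        using \<eta>_ge by linarith
    qed auto
    finally have half: "(1/2) ^ n \<le> \<eta>\<^sup>2 * (1/2) ^ k" .
    have "norm (w - e l) \<le> \<eta> * (5/4) ^ (l - k)" if l: "k \<le> l" "l < n" for l
    proof -
      define i where "i = l - k"
      have li: "l = a * (4 * m) + (p + i)"
        using l by (simp add: i_def k_def)
      show ?thesis
      \<comment> \<open>Either \<open>l\<close> is still in the row of \<open>k\<close>, where the
        drift is linear, or \<open>2 * m\<close> steps have passed and the diameter 2 of the sphere
        is already allowed.\<close>
      proof (cases "p + i < 4 * m")
        case True
        then have el: "e l = pt a (p + i)"
          unfolding e_def li using m by simp
        have "norm (w - e l) = norm ((w - pt a p) + (pt a p - pt a (p + i)))"
          by (simp add: el)
        also have "\<dots> \<le> 2 * DIM('a) / m + 2 * (i / m)"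
          by (intro norm_triangle_mono ek pt_lip a)
        also have "\<dots> \<le> \<eta> + 2 * (i / m)"
          using \<eta>_ge by simp
        also have "2 * (i / m) = (8 / m) * (i * (1/4))"
          by simp
        also have "\<eta> + (8 / m) * (i * (1/4)) \<le> \<eta> + \<eta> * (i * (1/4))"
          by (intro add_left_mono mult_right_mono \<eta>_ge) auto
        also have "\<dots> = \<eta> * (1 + i * (1/4))"
          by (simp add: algebra_simps)
        also have "\<dots> \<le> \<eta> * (5/4) ^ i"
          by (intro mult_left_mono bern) (simp add: \<eta>_def)
        finally show ?thesis
          by (simp add: i_def)
      next
        case False
        then have i: "2 * m \<le> i"
          using p by simp
        have "norm (w - e l) \<le> 1 + 1"
          using norm_triangle_ineq4[of w "e l"] w e_unit[OF l(2)] by simp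
        also have "\<dots> \<le> (8 / m) * (i * (1/4))"
          using i m by (simp add: field_simps)
        also have "\<dots> \<le> \<eta> * (5/4) ^ i"
          using bern[of i] by (intro mult_mono \<eta>_ge) (auto simp: \<eta>_def)
        finally show ?thesis
          by (simp add: i_def)
      qed
    qed
    then show ?thesis
      using half kn m by (intro exI[of _ k]) auto
  qed
  have "follows \<eta> n e"
    unfolding follows_def using e_unit cov by blast
  moreover have "real n \<le> 8 * DIM('a)\<^sup>2 * 3 ^ (DIM('a) - 2) * real m ^ (DIM('a) - 1)"
  proof -
    have "n \<le> DIM('a)\<^sup>2 * (2 * (3 * m) ^ (DIM('a) - 2)) * (4 * m)"
      unfolding n_def by (intro mult_right_mono R) auto
    also have "\<dots> = 8 * DIM('a)\<^sup>2 * 3 ^ (DIM('a) - 2) * (m * m ^ (DIM('a) - 2))"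
      by (simp add: power_mult_distrib)
    also have "m * m ^ (DIM('a) - 2) = m ^ (DIM('a) - 1)"
      using N by (simp add: Suc_diff_Suc numeral_2_eq_2 flip: power_Suc)
    finally have "real n \<le> real (8 * DIM('a)\<^sup>2 * 3 ^ (DIM('a) - 2) * m ^ (DIM('a) - 1))"
      by (rule of_nat_mono)
    then show ?thesis
      by simp
  qed
  ultimately show ?thesis
    unfolding \<eta>_def by blast
qed

subsection \<open>Choice of the scale\<close>

text \<open>Since \<open>n\<close> is at most of order \<open>m ^ d\<close>, the requirement
  \<open>\<delta> \<le> (1/2) ^ n\<close> permits \<open>m\<close> of order
  \<open>\<bar>ln \<delta>\<bar> powr (1 / d)\<close>. With \<eta> proportional to
  \<open>1 / m\<close>, the bound \<open>n * \<eta> ^ (d + 2)\<close> becomes a multiple of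
  \<open>1 / m\<^sup>2\<close>.\<close>

lemma small_sphere_family:
  assumes N: "2 \<le> DIM('a::euclidean_space)"
  shows "\<exists>C. \<forall>\<delta>. 0 < \<delta> \<and> \<delta> < 1 \<longrightarrow> (\<exists>K :: 'a set. compact K \<and>
    (\<forall>r\<in>{1..2}. \<exists>c. sphere c r \<subseteq> K) \<and>
    measure lebesgue (nbhd \<delta> K) \<le> C * \<bar>ln \<delta>\<bar> powr (- 2 / real (DIM('a) - 1)))"
proof -
  define d where "d = DIM('a) - 1"
  have d: "DIM('a) + 1 = d + 2" "0 < d"
    using N by (auto simp: d_def)
  define c where "c = 2 * real DIM('a) + 8"
  define C\<^sub>1 where "C\<^sub>1 = 8 * (real DIM('a))\<^sup>2 * 3 ^ (DIM('a) - 2)"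
  define W where "W = 2 * DIM('a) * 3 ^ DIM('a) * 2 ^ (DIM('a) + 1) * unit_ball_vol DIM('a) * 32 * 8 ^ d"
  define U where "U = measure lebesgue (cball 0 3 :: 'a set)"
  \<comment> \<open>The first summand serves small \<delta>, its 4 coming from
    \<open>x \<le> 2 * m\<close>; the second serves the range where \<open>x\<close> is
    bounded.\<close>
  define D where "D = 4 * (W * C\<^sub>1 * c ^ (d + 2)) + U * (17 * c + 1)\<^sup>2"
  have c: "8 \<le> c"
    by (simp add: c_def)
  have C1: "0 < C\<^sub>1"
    by (simp add: C\<^sub>1_def)
  have W: "0 \<le> W"
    by (simp add: W_def)
  have "\<exists>K :: 'a set. compact K \<and> (\<forall>r\<in>{1..2}. \<exists>c. sphere c r \<subseteq> K) \<and>
      measure lebesgue (nbhd \<delta> K) \<le> (D * C\<^sub>1 powr (2 / d)) * \<bar>ln \<delta>\<bar> powr (- 2 / d)"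
    if \<delta>: "0 < \<delta>" "\<delta> < 1" for \<delta>
  proof -
    define L where "L = \<bar>ln \<delta>\<bar>"
    have L: "0 < L" "\<delta> = exp (- L)"
      using \<delta> by (auto simp: L_def)
    \<comment> \<open>The solution of \<open>C\<^sub>1 * x ^ d = L\<close>; rounding it down to
      \<open>m\<close> keeps \<open>n \<le> L\<close>.\<close>
    define x where "x = (L / C\<^sub>1) powr (1 / d)"
    have x: "0 < x"
      using L C1 by (simp add: x_def)
    have xd: "x ^ d = L / C\<^sub>1"
      using L C1 d by (simp add: x_def powr_powr flip: powr_realpow)
    have "x\<^sup>2 = (L / C\<^sub>1) powr (2 / d)"
      using L C1 x by (simp add: x_def powr_powr flip: powr_realpow)
    then have bound: "D / x\<^sup>2 = (D * C\<^sub>1 powr (2 / d)) * \<bar>ln \<delta>\<bar> powr (- 2 / d)"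
      using L C1 by (simp add: powr_divide powr_minus_divide flip: L_def)
    show ?thesis
      unfolding bound[symmetric]
    \<comment> \<open>The extra 1 absorbs the rounding, so that
      \<open>c / m \<le> 1/17\<close>.\<close>
    proof (cases "17 * c + 1 \<le> x")
      case True
      define m where "m = nat \<lfloor>x\<rfloor>"
      have m: "real m \<le> x" "x \<le> 2 * m" "17 * c \<le> m"
        using True c unfolding m_def by linarith+
      have m0: "0 < real m"
        using m c by linarith
      obtain n and e :: "nat \<Rightarrow> 'a" where e: "follows (c / m) n e" and n: "real n \<le> C\<^sub>1 * real m ^ d"
        using ex_follows[OF N, of m] m0 unfolding c_def C\<^sub>1_def d_def by auto
      have "real n \<le> C\<^sub>1 * x ^ d"
        using n m C1 by (meson mult_left_mono order_trans power_mono of_nat_0_le_iff less_imp_le)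
      then have "real n \<le> L"
        using xd C1 by simp
      then have "\<delta> \<le> exp (- real n)"
        using L by simp
      also have "\<dots> = exp (- 1) ^ n"
        by (simp flip: exp_of_nat_mult)
      also have "\<dots> \<le> (1/2) ^ n"
      proof (intro power_mono)
        show "exp (- 1) \<le> (1/2 :: real)"
          using exp_ge_add_one_self[of 1] by (simp add: exp_minus field_simps)
      qed simp
      finally have \<delta>n: "\<delta> \<le> (1/2) ^ n" .
      have \<eta>: "0 < c / m" "c / m \<le> 1/17"
        using m m0 c by (auto simp: field_simps)
      have "measure lebesgue (nbhd \<delta> (shells n e)) \<le> W * n * (c / m) ^ (d + 2)"
        using measure_nbhd_shells_le[OF e \<eta> \<delta>n] unfolding W_def d(1) d_def[symmetric] by simp
      also have "\<dots> \<le> W * (C\<^sub>1 * real m ^ d) * (c / m) ^ (d + 2)"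
        using n W \<eta> by (intro mult_right_mono mult_left_mono zero_le_power) auto
      also have "\<dots> = W * C\<^sub>1 * c ^ (d + 2) / (real m)\<^sup>2"
        using m0 by (simp add: power_divide power_add power2_eq_square)
      also have "\<dots> \<le> W * C\<^sub>1 * c ^ (d + 2) / (x / 2)\<^sup>2"
        using m x W C1 c by (intro divide_left_mono power_mono) auto
      also have "\<dots> = 4 * (W * C\<^sub>1 * c ^ (d + 2)) / x\<^sup>2"
        by (simp add: power_divide)
      also have "\<dots> \<le> D / x\<^sup>2"
        by (intro divide_right_mono) (auto simp: D_def U_def)
      finally show "\<exists>K :: 'a set. compact K \<and> (\<forall>r\<in>{1..2}. \<exists>c. sphere c r \<subseteq> K) \<and>
          measure lebesgue (nbhd \<delta> K) \<le> D / x\<^sup>2"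
        using compact_shells sphere_subset_shells by (intro exI[of _ "shells n e"]) auto
    next
      case False
      \<comment> \<open>Here concentric spheres suffice: \<open>x\<close> is bounded, so a fixed
        volume is at most a constant times \<open>1 / x\<^sup>2\<close>.\<close>
      have "nbhd \<delta> (cball 0 2 :: 'a set) \<subseteq> cball 0 3"
      proof
        fix z assume "z \<in> nbhd \<delta> (cball 0 2 :: 'a set)"
        then obtain y where "dist z y < \<delta>" "norm y \<le> 2"
          by (auto simp: nbhd_def)
        then show "z \<in> cball 0 3"
          using \<delta> norm_triangle_sub[of z y] by (simp add: dist_norm)
      qed
      then have "measure lebesgue (nbhd \<delta> (cball 0 2 :: 'a set)) \<le> U"
        unfolding U_def by (intro measure_mono_fmeasurable) (auto simp: open_nbhd)
      also have "\<dots> = U * x\<^sup>2 / x\<^sup>2"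
        using x by simp
      also have "\<dots> \<le> U * (17 * c + 1)\<^sup>2 / x\<^sup>2"
        using False x by (intro divide_right_mono mult_left_mono power_mono) (auto simp: U_def)
      also have "\<dots> \<le> D / x\<^sup>2"
        using W C1 c by (intro divide_right_mono) (auto simp: D_def)
      finally show "\<exists>K :: 'a set. compact K \<and> (\<forall>r\<in>{1..2}. \<exists>c. sphere c r \<subseteq> K) \<and>
          measure lebesgue (nbhd \<delta> K) \<le> D / x\<^sup>2"
        by (intro exI[of _ "cball 0 2"]) (auto intro!: exI[of _ 0])
    qed
  qed
  then show ?thesis
    unfolding d_def by blast
qed

theorem theorem1p1:
  fixes d :: nat
  assumes "d \<ge> 1"
    and "CARD('n::finite) = d + 1"
  shows "\<exists>C::real. \<forall>\<delta>::real. 0 < \<delta> \<and> \<delta> < 1 \<longrightarrow>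
    (\<exists>K::(real ^ 'n) set. compact K \<and>
      (\<forall>r\<in>{1..2}. \<exists>c. sphere c r \<subseteq> K) \<and>
      measure lebesgue (nbhd \<delta> K) \<le> C * \<bar>ln \<delta>\<bar> powr (- 2 / real d))"
  using small_sphere_family[where 'a = "real ^ 'n"] assms by simp

end
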